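(* Let $\gamma:I\to\mathbb{R}^3$ be a unit-speed curve $M$ with Serret-Frenet apparatus $\{T,N,B,\kappa,\tau\}$, and let $V=uT+vN+wB$ be a unit vector field along $\gamma$, where $u,v,w:I\to\mathbb{R}$ are differentiable functions with $u^2+v^2+w^2=1$. Then $M$ is a $V$-Bertrand curve if and only if there is a differentiable function $\lambda:I\to\mathbb{R}$, for which the curve $\beta(s)=\int V(s)\,ds+\lambda(s)N(s)$ has a Frenet frame $\{\overline T,\overline N,\overline B\}$, and a constant $\theta$ such that $$\lambda\,(\kappa\tan\theta+\tau)=u\tan\theta-w\quad\text{on } I$$ and $$\lambda(s)=-\int v(s)\,ds,$$ where $\theta$ is the constant angle between $T$ and $\overline T$.
   Context: All curves and functions are smooth (as differentiable as needed), and $I$ is an open interval. $M$ is assumed to have a Frenet frame, $\kappa>0$, with Frenet equations $T'=\kappa N$, $N'=-\kappa T+\tau B$, $B'=-\tau N$. Integral notation: $\int V\,ds$ denotes any curve whose derivative is $V$, and $\lambda=-\int v\,ds$ means that $\lambda$ is some antiderivative of $-v$, i.e. $\lambda'=-v$ on $I$. For a differentiable $\lambda:I\to\mathbb{R}$ let $K$ be the curve $\beta(s)=\int V(s)\,ds+\lambda(s)N(s)$. It is always assumed that $K$ has a Frenet frame $\{\overline T,\overline N,\overline B\}$, i.e. that $\beta$ is regular with nowhere zero curvature. The pair $(M,K)$ is called a $V$-Bertrand mate if $\{N,\overline N\}$ is linearly dependent at corresponding parameters, i.e. $\overline N=\epsilon N$ with $\epsilon=\pm1$. $M$ is called a $V$-Bertrand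 curve if there is such a $\lambda$ for which $(M,K)$ is a $V$-Bertrand mate. The angle $\theta$ is measured in the plane of $T$ and $B$, modulo $\pi$: $\overline T=\pm(\cos\theta\,T+\sin\theta\,B)$. The value $\cos\theta=0$ is allowed; the first displayed equation is then understood after multiplication by $\cos\theta$, i.e. as $\lambda(\kappa\sin\theta+\tau\cos\theta)=u\sin\theta-w\cos\theta$. *)

theory Defs
  imports "HOL-Analysis.Analysis"
begin

text \<open>
  Curves are functions on the reals, of which only the values on an open parameter interval \<open>I\<close>
  matter; hence all derivatives are two-sided. No unit-speed assumption is built into the
  Frenet apparatus, because the companion curve \<open>\<beta>\<close> below is in general not parametrised
  by arc length.
\<close>

definition speed :: "(real \<Rightarrow> real^3) \<Rightarrow> real \<Rightarrow> real" where
  "speed \<beta> s = norm (vector_derivative \<beta> (at s))"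

definition frenet_T :: "(real \<Rightarrow> real^3) \<Rightarrow> real \<Rightarrow> real^3" where
  "frenet_T \<beta> s = vector_derivative \<beta> (at s) /\<^sub>R speed \<beta> s"

definition curvature :: "(real \<Rightarrow> real^3) \<Rightarrow> real \<Rightarrow> real" where
  "curvature \<beta> s = norm (vector_derivative (frenet_T \<beta>) (at s)) / speed \<beta> s"

definition frenet_N :: "(real \<Rightarrow> real^3) \<Rightarrow> real \<Rightarrow> real^3" where
  "frenet_N \<beta> s = vector_derivative (frenet_T \<beta>) (at s) /\<^sub>R norm (vector_derivative (frenet_T \<beta>) (at s))"

definition frenet_B :: "(real \<Rightarrow> real^3) \<Rightarrow> real \<Rightarrow> real^3" where
  "frenet_B \<beta> s = cross3 (frenet_T \<beta> s) (frenet_N \<beta> s)"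

definition torsion :: "(real \<Rightarrow> real^3) \<Rightarrow> real \<Rightarrow> real" where
  "torsion \<beta> s = - (vector_derivative (frenet_B \<beta>) (at s) \<bullet> frenet_N \<beta> s) / speed \<beta> s"

text \<open>
  Regular with nowhere zero curvature. The differentiability clauses are exactly what is needed
  for the frame to exist and to satisfy the Frenet equations; they hold for every smooth curve
  that is regular with nowhere zero curvature.
\<close>

definition has_frenet_frame :: "real set \<Rightarrow> (real \<Rightarrow> real^3) \<Rightarrow> bool" where
  "has_frenet_frame I \<beta> \<longleftrightarrow>
     (\<forall>s\<in>I. \<beta> differentiable (at s) \<and> vector_derivative \<beta> (at s) \<noteq> 0 \<and>
            frenet_T \<beta> differentiable (at s) \<and> curvature \<beta> s > 0 \<and>
            frenet_N \<beta> differentiable (at s))"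

text \<open>
  \<open>\<beta>\<close> is one of the curves \<open>\<integral>V ds + lam N\<close>. The antiderivative of \<open>V\<close> is unique up to
  a translation of \<open>\<beta>\<close>, which does not affect the Frenet apparatus.
\<close>

definition companion_curve ::
  "real set \<Rightarrow> (real \<Rightarrow> real^3) \<Rightarrow> (real \<Rightarrow> real^3) \<Rightarrow> (real \<Rightarrow> real) \<Rightarrow> (real \<Rightarrow> real^3) \<Rightarrow> bool" where
  "companion_curve I \<gamma> V lam \<beta> \<longleftrightarrow>
     (\<exists>W. (\<forall>s\<in>I. (W has_vector_derivative V s) (at s)) \<and>
          (\<forall>s\<in>I. \<beta> s = W s + lam s *\<^sub>R frenet_N \<gamma> s))"

text \<open>
  For unit vectors, linear dependence means equality up to sign. It is not expressed by
  \<open>dependent {N, N'}\<close>, which would be false for \<open>N = N'\<close>.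
\<close>

definition V_Bertrand_mate ::
  "real set \<Rightarrow> (real \<Rightarrow> real^3) \<Rightarrow> (real \<Rightarrow> real^3) \<Rightarrow> (real \<Rightarrow> real) \<Rightarrow> (real \<Rightarrow> real^3) \<Rightarrow> bool" where
  "V_Bertrand_mate I \<gamma> V lam \<beta> \<longleftrightarrow>
     companion_curve I \<gamma> V lam \<beta> \<and> has_frenet_frame I \<beta> \<and>
     (\<forall>s\<in>I. \<exists>\<epsilon>\<in>{1, -1}. frenet_N \<beta> s = \<epsilon> *\<^sub>R frenet_N \<gamma> s)"

definition V_Bertrand_curve :: "real set \<Rightarrow> (real \<Rightarrow> real^3) \<Rightarrow> (real \<Rightarrow> real^3) \<Rightarrow> bool" where
  "V_Bertrand_curve I \<gamma> V \<longleftrightarrow>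
     (\<exists>lam \<beta>. (\<forall>s\<in>I. lam differentiable (at s)) \<and> V_Bertrand_mate I \<gamma> V lam \<beta>)"

text \<open>
  \<open>\<theta>\<close> is the angle, modulo \<open>\<pi>\<close> and oriented from \<open>T\<close> towards \<open>B\<close>, between the tangents of
  \<open>\<gamma>\<close> and \<open>\<beta>\<close> at \<open>s\<close>; in particular the tangent of \<open>\<beta>\<close> lies in the plane of \<open>T\<close> and \<open>B\<close>.
\<close>

definition tangent_angle :: "(real \<Rightarrow> real^3) \<Rightarrow> (real \<Rightarrow> real^3) \<Rightarrow> real \<Rightarrow> real \<Rightarrow> bool" where
  "tangent_angle \<gamma> \<beta> \<theta> s \<longleftrightarrow>
     (\<exists>\<epsilon>\<in>{1, -1}. frenet_T \<beta> s = \<epsilon> *\<^sub>R (cos \<theta> *\<^sub>R frenet_T \<gamma> s + sin \<theta> *\<^sub>R frenet_B \<gamma> s))"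

end

theory Submission
  imports Defs
begin

text \<open>
  Since \<open>\<beta>' = (u - \<lambda>\<kappa>) T + (v + \<lambda>') N + (w + \<lambda>\<tau>) B\<close>, the tangent of \<open>\<beta>\<close> lies in the plane of
  \<open>T\<close> and \<open>B\<close> iff \<open>\<lambda>' = -v\<close>, and its angle in that plane is \<open>\<theta>\<close> iff the first displayed equation
  holds. As \<open>T'\<close> and \<open>B'\<close> are multiples of \<open>N\<close>, a unit field in the plane of \<open>T\<close> and \<open>B\<close> has
  constant coordinates iff its derivative is a multiple of \<open>N\<close>, so constancy of \<open>\<theta>\<close> is equivalent to
  the principal normals being parallel.
\<close>

section \<open>Expansion in an orthonormal frame completed by the cross product\<close>

lemma orthonormal_cross3_expansion:
  fixes a b x :: "real^3"
  assumes "norm a = 1" "norm b = 1" "a \<bullet> b = 0"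
  shows "x = (x \<bullet> a) *\<^sub>R a + (x \<bullet> b) *\<^sub>R b + (x \<bullet> cross3 a b) *\<^sub>R cross3 a b"
proof -
  define c where "c = cross3 a b"
  have aa: "a \<bullet> a = 1" and bb: "b \<bullet> b = 1"
    using assms by (simp_all add: dot_square_norm)
  have ba: "b \<bullet> a = 0"
    using assms(3) by (simp add: inner_commute)
  have "(norm c)\<^sup>2 = 1"
    using norm_cross_dot[of a b] assms by (simp add: c_def)
  then have cc: "c \<bullet> c = 1" and nc: "norm c = 1"
    by (simp_all add: dot_square_norm abs_square_eq_1)
  have orth: "c \<bullet> a = 0" "c \<bullet> b = 0" "a \<bullet> c = 0" "b \<bullet> c = 0"
    by (simp_all add: c_def dot_cross_self)
  define y where "y = x - ((x \<bullet> a) *\<^sub>R a + (x \<bullet> b) *\<^sub>R b + (x \<bullet> c) *\<^sub>R c)"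
  have y: "y \<bullet> a = 0" "y \<bullet> b = 0" "y \<bullet> c = 0"
    by (simp_all add: y_def inner_add_left inner_diff_left aa bb cc ba orth assms(3))
  \<comment> \<open>The residue \<open>y\<close> is shown to vanish without a dimension count. The
    triple product formula turns \<open>cross3 y c\<close> into a combination of \<open>a\<close>
    and \<open>b\<close> whose coefficients are zero. As \<open>y\<close> is also orthogonal to the
    unit vector \<open>c\<close>, the identity relating the norms of cross and dot products leaves
    only \<open>y = 0\<close>.\<close>
  have "cross3 y c = (y \<bullet> b) *\<^sub>R a - (y \<bullet> a) *\<^sub>R b"
    unfolding c_def by (simp add: Lagrange)
  then have "cross3 y c = 0"
    by (simp add: y)
  then have "y = 0"
    using norm_cross_dot[of y c] y(3) nc by simp
  then show ?thesis
    unfolding y_def c_def by (rule eq_iff_diff_eq_0[THEN iffD2])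
qed

section \<open>Differentiating inner products\<close>

lemma has_vector_derivative_inner:
  fixes f g :: "real \<Rightarrow> 'a::real_inner"
  assumes "(f has_vector_derivative f') (at s)" "(g has_vector_derivative g') (at s)"
  shows "((\<lambda>t. f t \<bullet> g t) has_vector_derivative f s \<bullet> g' + f' \<bullet> g s) (at s)"
  by (rule bounded_bilinear.has_vector_derivative[OF bounded_bilinear_inner assms])

text \<open>This is the device that turns orthonormality of a frame into relations between
  derivatives. Openness of \<open>I\<close> lets an identity valid only on \<open>I\<close>
  determine two-sided derivatives.\<close>

lemma inner_derivative_const:
  fixes f g :: "real \<Rightarrow> 'a::real_inner"
  assumes "open I" "s \<in> I" "\<And>t. t \<in> I \<Longrightarrow> f t \<bullet> g t = c"
    and "(f has_vector_derivative f') (at s)" "(g has_vector_derivative g') (at s)"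
  shows "f s \<bullet> g' + f' \<bullet> g s = 0"
proof -
  have "((\<lambda>t. c) has_vector_derivative f s \<bullet> g' + f' \<bullet> g s) (at s)"
    by (rule has_vector_derivative_transform_within_open[OF
          has_vector_derivative_inner[OF assms(4,5)] assms(1,2,3)])
  from vector_derivative_unique_at[OF this has_vector_derivative_const] show ?thesis .
qed

lemma unit_vector_derivative_orthogonal:
  fixes f :: "real \<Rightarrow> 'a::real_inner"
  assumes "open I" "s \<in> I" "\<And>t. t \<in> I \<Longrightarrow> norm (f t) = 1"
    and "(f has_vector_derivative f') (at s)"
  shows "f' \<bullet> f s = 0"
  using inner_derivative_const[OF assms(1,2) _ assms(4,4), of 1] assms(3)
  by (simp add: dot_square_norm inner_commute)

text \<open>Convexity of the interval makes one constant serve all of \<open>I\<close>; this is what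
  later yields a single \<theta>.\<close>

lemma constant_on_open_interval:
  fixes f :: "real \<Rightarrow> real"
  assumes "open I" "is_interval I"
    and "\<And>s. s \<in> I \<Longrightarrow> (f has_vector_derivative 0) (at s)"
  shows "\<exists>c. \<forall>s\<in>I. f s = c"
proof -
  have "(f has_field_derivative 0) (at s within I)" if "s \<in> I" for s
    by (rule has_field_derivative_at_within)
      (simp add: has_real_derivative_iff_has_vector_derivative assms(3) that)
  from has_field_derivative_zero_constant[OF is_interval_convex[OF assms(2)] this]
  show ?thesis by blast
qed

section \<open>Frenet equations at arbitrary speed\<close>

context
  fixes I :: "real set" and \<beta> :: "real \<Rightarrow> real^3" and s :: real
  assumes opn: "open I" and fr: "has_frenet_frame I \<beta>" and s: "s \<in> I"
begin

lemma speed_pos: "speed \<beta> s > 0"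
  using fr s by (simp add: has_frenet_frame_def speed_def)

lemma velocity_eq: "vector_derivative \<beta> (at s) = speed \<beta> s *\<^sub>R frenet_T \<beta> s"
  using speed_pos by (simp add: frenet_T_def)

lemma norm_frenet_T: "norm (frenet_T \<beta> s) = 1"
  using speed_pos by (simp add: frenet_T_def speed_def)

lemma norm_deriv_frenet_T:
  "norm (vector_derivative (frenet_T \<beta>) (at s)) = speed \<beta> s * curvature \<beta> s"
  using speed_pos by (simp add: curvature_def)

lemma norm_deriv_frenet_T_pos: "norm (vector_derivative (frenet_T \<beta>) (at s)) > 0"
  unfolding norm_deriv_frenet_T using fr s speed_pos by (simp add: has_frenet_frame_def)

lemma norm_frenet_N: "norm (frenet_N \<beta> s) = 1"
  using norm_deriv_frenet_T_pos by (simp add: frenet_N_def)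

lemma frenet_T_derivative:
  "(frenet_T \<beta> has_vector_derivative (speed \<beta> s * curvature \<beta> s) *\<^sub>R frenet_N \<beta> s) (at s)"
proof -
  have "(frenet_T \<beta> has_vector_derivative vector_derivative (frenet_T \<beta>) (at s)) (at s)"
    using fr s by (simp add: has_frenet_frame_def vector_derivative_works)
  moreover have "vector_derivative (frenet_T \<beta>) (at s) = (speed \<beta> s * curvature \<beta> s) *\<^sub>R frenet_N \<beta> s"
    using norm_deriv_frenet_T_pos by (simp add: frenet_N_def norm_deriv_frenet_T[symmetric])
  ultimately show ?thesis by simp
qed

lemma frenet_N_derivative:
  "(frenet_N \<beta> has_vector_derivative vector_derivative (frenet_N \<beta>) (at s)) (at s)"
  using fr s by (simp add: has_frenet_frame_def vector_derivative_works)

end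

text \<open>The derivative of a unit field is orthogonal to the field, and here that derivative is a
  positive multiple of \<open>frenet_N\<close>.\<close>

lemma frenet_T_N:
  assumes "open I" "has_frenet_frame I \<beta>" "s \<in> I"
  shows "frenet_T \<beta> s \<bullet> frenet_N \<beta> s = 0"
proof -
  have "((speed \<beta> s * curvature \<beta> s) *\<^sub>R frenet_N \<beta> s) \<bullet> frenet_T \<beta> s = 0"
    using unit_vector_derivative_orthogonal[OF assms(1,3) norm_frenet_T[OF assms(1,2)]
        frenet_T_derivative[OF assms]] by blast
  moreover have "speed \<beta> s * curvature \<beta> s > 0"
    using speed_pos[OF assms] assms(2,3) by (simp add: has_frenet_frame_def)
  ultimately show ?thesis
    by (auto simp: inner_commute)
qed

lemma norm_frenet_B:
  assumes "open I" "has_frenet_frame I \<beta>" "s \<in> I"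
  shows "norm (frenet_B \<beta> s) = 1"
proof -
  have "(norm (frenet_B \<beta> s))\<^sup>2 = 1"
    using norm_cross_dot[of "frenet_T \<beta> s" "frenet_N \<beta> s"] frenet_T_N[OF assms]
      norm_frenet_T[OF assms] norm_frenet_N[OF assms]
    by (simp add: frenet_B_def)
  then show ?thesis
    by (simp add: abs_square_eq_1)
qed

lemma frenet_inner:
  assumes "open I" "has_frenet_frame I \<beta>" "s \<in> I"
  shows "frenet_T \<beta> s \<bullet> frenet_T \<beta> s = 1" "frenet_N \<beta> s \<bullet> frenet_N \<beta> s = 1"
    "frenet_B \<beta> s \<bullet> frenet_B \<beta> s = 1"
    "frenet_T \<beta> s \<bullet> frenet_N \<beta> s = 0" "frenet_N \<beta> s \<bullet> frenet_T \<beta> s = 0"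
    "frenet_T \<beta> s \<bullet> frenet_B \<beta> s = 0" "frenet_B \<beta> s \<bullet> frenet_T \<beta> s = 0"
    "frenet_N \<beta> s \<bullet> frenet_B \<beta> s = 0" "frenet_B \<beta> s \<bullet> frenet_N \<beta> s = 0"
  using norm_frenet_T[OF assms] norm_frenet_N[OF assms] norm_frenet_B[OF assms] frenet_T_N[OF assms]
  by (simp_all add: dot_square_norm inner_commute frenet_B_def dot_cross_self)

lemma frenet_expansion:
  assumes "open I" "has_frenet_frame I \<beta>" "s \<in> I"
  shows "x = (x \<bullet> frenet_T \<beta> s) *\<^sub>R frenet_T \<beta> s + (x \<bullet> frenet_N \<beta> s) *\<^sub>R frenet_N \<beta> s
    + (x \<bullet> frenet_B \<beta> s) *\<^sub>R frenet_B \<beta> s"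
  unfolding frenet_B_def
  by (rule orthonormal_cross3_expansion[OF norm_frenet_T[OF assms] norm_frenet_N[OF assms]
        frenet_T_N[OF assms]])

text \<open>The product rule for T \<times> N leaves only T \<times> N', because T' is parallel to
  N. What is left is orthogonal to T, and to B by the unit length of B, so it is a multiple of N;
  the definition of \<open>torsion\<close> supplies the coefficient.\<close>

lemma frenet_B_derivative:
  assumes "open I" "has_frenet_frame I \<beta>" "s \<in> I"
  shows "(frenet_B \<beta> has_vector_derivative - (speed \<beta> s * torsion \<beta> s) *\<^sub>R frenet_N \<beta> s) (at s)"
proof -
  let ?N' = "vector_derivative (frenet_N \<beta>) (at s)"
  define B' where "B' = cross3 (frenet_T \<beta> s) ?N'"
  have "bounded_bilinear cross3"
    using bilinear_cross by (simp add: bilinear_conv_bounded_bilinear)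
  from bounded_bilinear.has_vector_derivative[OF this frenet_T_derivative[OF assms]
      frenet_N_derivative[OF assms]]
  have B': "(frenet_B \<beta> has_vector_derivative B') (at s)"
    by (simp add: B'_def frenet_B_def[abs_def] cross_mult_left)
  have T: "B' \<bullet> frenet_T \<beta> s = 0"
    by (simp add: B'_def dot_cross_self)
  have B: "B' \<bullet> frenet_B \<beta> s = 0"
    using unit_vector_derivative_orthogonal[OF assms(1,3) norm_frenet_B[OF assms(1,2)] B'] by blast
  have N: "B' \<bullet> frenet_N \<beta> s = - (speed \<beta> s * torsion \<beta> s)"
    using speed_pos[OF assms] by (simp add: torsion_def vector_derivative_at[OF B'])
  have "- (speed \<beta> s * torsion \<beta> s) *\<^sub>R frenet_N \<beta> s = B'"
    using frenet_expansion[OF assms, of B', unfolded T B N, symmetric] by simp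
  with B' show ?thesis
    by (rule has_vector_derivative_eq_rhs[OF _ sym])
qed

section \<open>The velocity of the companion curve and its components\<close>

lemma velocity_companion_curve:
  assumes "open I" "has_frenet_frame I \<gamma>" "companion_curve I \<gamma> V lam \<beta>" "s \<in> I"
    and "(lam has_real_derivative l) (at s)"
  shows "vector_derivative \<beta> (at s) =
    V s + lam s *\<^sub>R vector_derivative (frenet_N \<gamma>) (at s) + l *\<^sub>R frenet_N \<gamma> s"
proof -
  obtain W where "\<forall>t\<in>I. (W has_vector_derivative V t) (at t)"
    "\<forall>t\<in>I. \<beta> t = W t + lam t *\<^sub>R frenet_N \<gamma> t"
    using assms(3) unfolding companion_curve_def by blast
  with assms(4) have W: "(W has_vector_derivative V s) (at s)"
    "\<And>t. t \<in> I \<Longrightarrow> W t + lam t *\<^sub>R frenet_N \<gamma> t = \<beta> t"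
    by simp_all
  \<comment> \<open>The derivative \<open>l\<close> of \<open>lam\<close> is kept arbitrary, since
    in one direction of the theorem its value \<open>- v s\<close> has to be deduced.\<close>
  have "((\<lambda>t. W t + lam t *\<^sub>R frenet_N \<gamma> t) has_vector_derivative
      V s + (lam s *\<^sub>R vector_derivative (frenet_N \<gamma>) (at s) + l *\<^sub>R frenet_N \<gamma> s)) (at s)"
    by (intro has_vector_derivative_add W has_vector_derivative_scaleR assms
        frenet_N_derivative[OF assms(1,2,4)])
  from has_vector_derivative_transform_within_open[OF this assms(1,4) W(2)]
  show ?thesis
    by (simp add: vector_derivative_at add.assoc)
qed

text \<open>These are the components of the remaining Frenet equation. They come from
  differentiating the constants N \<bullet> T, N \<bullet> N and N \<bullet> B and inserting the
  known T' and B'. The component form is what projecting the velocity onto the frame calls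
  for.\<close>

lemma frenet_N_derivative_inner:
  assumes "open I" "has_frenet_frame I \<beta>" "s \<in> I"
  shows "vector_derivative (frenet_N \<beta>) (at s) \<bullet> frenet_T \<beta> s = - (speed \<beta> s * curvature \<beta> s)"
    "vector_derivative (frenet_N \<beta>) (at s) \<bullet> frenet_N \<beta> s = 0"
    "vector_derivative (frenet_N \<beta>) (at s) \<bullet> frenet_B \<beta> s = speed \<beta> s * torsion \<beta> s"
proof -
  note N' = frenet_N_derivative[OF assms]
  note orth = frenet_inner[OF assms(1,2)]
  show "vector_derivative (frenet_N \<beta>) (at s) \<bullet> frenet_T \<beta> s = - (speed \<beta> s * curvature \<beta> s)"
    using inner_derivative_const[OF assms(1,3) orth(5) N' frenet_T_derivative[OF assms]]
    by (simp add: orth assms)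
  show "vector_derivative (frenet_N \<beta>) (at s) \<bullet> frenet_N \<beta> s = 0"
    using unit_vector_derivative_orthogonal[OF assms(1,3) norm_frenet_N[OF assms(1,2)] N'] by blast
  show "vector_derivative (frenet_N \<beta>) (at s) \<bullet> frenet_B \<beta> s = speed \<beta> s * torsion \<beta> s"
    using inner_derivative_const[OF assms(1,3) orth(8) N' frenet_B_derivative[OF assms]]
    by (simp add: orth assms)
qed

section \<open>Parallel principal normals and constant tangent angle\<close>

lemma parallel_normals_imp_tangent_angle:
  assumes "open I" "is_interval I" "has_frenet_frame I \<gamma>" "has_frenet_frame I \<beta>"
    and par: "\<forall>s\<in>I. \<exists>\<epsilon>\<in>{1, -1}. frenet_N \<beta> s = \<epsilon> *\<^sub>R frenet_N \<gamma> s"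
  obtains \<theta> where "\<And>s. s \<in> I \<Longrightarrow>
    frenet_T \<beta> s = cos \<theta> *\<^sub>R frenet_T \<gamma> s + sin \<theta> *\<^sub>R frenet_B \<gamma> s"
proof -
  note orth\<beta> = frenet_inner[OF assms(1,4)]
  note orth = frenet_inner[OF assms(1,3)]
  \<comment> \<open>The sign \<epsilon> may depend on \<open>s\<close>, and its continuity is not at
    hand. Only these orthogonality relations, which do not see the sign, are passed on.\<close>
  have NT: "frenet_T \<beta> s \<bullet> frenet_N \<gamma> s = 0" "frenet_N \<beta> s \<bullet> frenet_T \<gamma> s = 0"
    "frenet_N \<beta> s \<bullet> frenet_B \<gamma> s = 0" if s: "s \<in> I" for s
  proof -
    obtain \<epsilon> where \<epsilon>: "\<epsilon> \<in> {1, -1}" "frenet_N \<beta> s = \<epsilon> *\<^sub>R frenet_N \<gamma> s"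
      using par s by blast
    show "frenet_N \<beta> s \<bullet> frenet_T \<gamma> s = 0" "frenet_N \<beta> s \<bullet> frenet_B \<gamma> s = 0"
      by (simp_all add: \<epsilon>(2) orth[OF s])
    show "frenet_T \<beta> s \<bullet> frenet_N \<gamma> s = 0"
      using orth\<beta>(4)[OF s, unfolded \<epsilon>(2)] \<epsilon>(1) by auto
  qed
  \<comment> \<open>The derivatives of \<open>frenet_T\<close> and \<open>frenet_B\<close> are
    multiples of the normals, so every term of the product rule contains one of the inner products
    in \<open>NT\<close>.\<close>
  have "((\<lambda>t. frenet_T \<beta> t \<bullet> frenet_T \<gamma> t) has_vector_derivative 0) (at s)" if "s \<in> I" for s
    using has_vector_derivative_inner[OF frenet_T_derivative[OF assms(1,4) that]
        frenet_T_derivative[OF assms(1,3) that]] by (simp add: NT that)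
  from constant_on_open_interval[OF assms(1,2) this]
  obtain p where p: "\<forall>s\<in>I. frenet_T \<beta> s \<bullet> frenet_T \<gamma> s = p" by blast
  have "((\<lambda>t. frenet_T \<beta> t \<bullet> frenet_B \<gamma> t) has_vector_derivative 0) (at s)" if "s \<in> I" for s
    using has_vector_derivative_inner[OF frenet_T_derivative[OF assms(1,4) that]
        frenet_B_derivative[OF assms(1,3) that]] by (simp add: NT that)
  from constant_on_open_interval[OF assms(1,2) this]
  obtain q where q: "\<forall>s\<in>I. frenet_T \<beta> s \<bullet> frenet_B \<gamma> s = q" by blast
  have T: "frenet_T \<beta> s = p *\<^sub>R frenet_T \<gamma> s + q *\<^sub>R frenet_B \<gamma> s" if "s \<in> I" for s
    using frenet_expansion[OF assms(1,3) that, of "frenet_T \<beta> s",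
        unfolded p[rule_format, OF that] q[rule_format, OF that] NT(1)[OF that]]
    by simp
  show thesis
  \<comment> \<open>A point of \<open>I\<close> is needed to see that \<open>p\<close> and
    \<open>q\<close> lie on the unit circle and hence are the cosine and sine of some
    \<theta>.\<close>
  proof (cases "I = {}")
    case False
    then obtain s where s: "s \<in> I" by blast
    have "p\<^sup>2 + q\<^sup>2 = 1"
      using orth\<beta>(1)[OF s, unfolded T[OF s]]
      by (simp add: inner_add_left inner_add_right orth[OF s] power2_eq_square)
    then obtain \<theta> where "p = cos \<theta>" "q = sin \<theta>"
      by (rule sincos_total_2pi)
    then show thesis
      using T by (intro that[of \<theta>]) simp
  qed (rule that[of 0], simp)
qed

text \<open>Write D for cos \<theta> T + sin \<theta> B and let E be D turned by a right angle, so
  that D, E, N is an orthonormal basis. The normal of \<beta> is orthogonal to D because its tangent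
  is D up to sign, and orthogonal to E by differentiating
  \<open>frenet_T \<beta> t \<bullet> E t = 0\<close>. Using this relation avoids differentiating a
  tangent whose sign might vary with the parameter.\<close>

lemma tangent_angle_imp_parallel_normals:
  assumes "open I" "has_frenet_frame I \<gamma>" "has_frenet_frame I \<beta>"
    and angle: "\<forall>s\<in>I. tangent_angle \<gamma> \<beta> \<theta> s" and s: "s \<in> I"
  shows "\<exists>\<epsilon>\<in>{1, -1}. frenet_N \<beta> s = \<epsilon> *\<^sub>R frenet_N \<gamma> s"
proof -
  note orth = frenet_inner[OF assms(1,2)]
  note dT = frenet_T_derivative[OF assms(1,2)] frenet_B_derivative[OF assms(1,2)]
  note dT\<beta> = frenet_T_derivative[OF assms(1,3) s]
  define E where "E t = cos \<theta> *\<^sub>R frenet_B \<gamma> t - sin \<theta> *\<^sub>R frenet_T \<gamma> t" for t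
  define a where "a = - cos \<theta> * (speed \<gamma> s * torsion \<gamma> s) - sin \<theta> * (speed \<gamma> s * curvature \<gamma> s)"
  have dE: "(E has_vector_derivative a *\<^sub>R frenet_N \<gamma> s) (at s)"
  proof -
    have "((\<lambda>t. cos \<theta> *\<^sub>R frenet_B \<gamma> t - sin \<theta> *\<^sub>R frenet_T \<gamma> t) has_vector_derivative
        cos \<theta> *\<^sub>R (- (speed \<gamma> s * torsion \<gamma> s) *\<^sub>R frenet_N \<gamma> s)
        - sin \<theta> *\<^sub>R ((speed \<gamma> s * curvature \<gamma> s) *\<^sub>R frenet_N \<gamma> s)) (at s)"
      by (intro has_vector_derivative_diff bounded_linear.has_vector_derivative[OF
            bounded_linear_scaleR_right] dT s)
    then show ?thesis
      by (simp add: E_def[abs_def] a_def scaleR_diff_left)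
  qed
  have TN: "frenet_T \<beta> t \<bullet> frenet_N \<gamma> t = 0" and TE: "frenet_T \<beta> t \<bullet> E t = 0" if t: "t \<in> I" for t
  proof -
    obtain \<epsilon> where "frenet_T \<beta> t = \<epsilon> *\<^sub>R (cos \<theta> *\<^sub>R frenet_T \<gamma> t + sin \<theta> *\<^sub>R frenet_B \<gamma> t)"
      using angle t unfolding tangent_angle_def by blast
    then show "frenet_T \<beta> t \<bullet> frenet_N \<gamma> t = 0" "frenet_T \<beta> t \<bullet> E t = 0"
      by (simp_all add: E_def inner_add_left inner_diff_right orth[OF t])
  qed
  have pos: "speed \<beta> s * curvature \<beta> s > 0"
    using speed_pos[OF assms(1,3) s] assms(3) s by (simp add: has_frenet_frame_def)
  \<comment> \<open>The term with E' drops out, since E' is a multiple of the normal of \<gamma>, to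
    which the tangent of \<beta> is orthogonal. The positive factor in front of
    \<open>frenet_N \<beta> s\<close> can then be cancelled.\<close>
  have NE: "frenet_N \<beta> s \<bullet> E s = 0"
    using inner_derivative_const[OF assms(1) s TE dT\<beta> dE] TN[OF s] pos by auto
  have NT: "frenet_N \<beta> s \<bullet> (cos \<theta> *\<^sub>R frenet_T \<gamma> s + sin \<theta> *\<^sub>R frenet_B \<gamma> s) = 0"
  proof -
    obtain \<epsilon> where "\<epsilon> \<in> {1, -1}"
      "frenet_T \<beta> s = \<epsilon> *\<^sub>R (cos \<theta> *\<^sub>R frenet_T \<gamma> s + sin \<theta> *\<^sub>R frenet_B \<gamma> s)"
      using angle s unfolding tangent_angle_def by blast
    then show ?thesis
      using frenet_inner(5)[OF assms(1,3) s] by auto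
  qed
  define x y where "x = frenet_N \<beta> s \<bullet> frenet_T \<gamma> s" and "y = frenet_N \<beta> s \<bullet> frenet_B \<gamma> s"
  have 1: "cos \<theta> * y - sin \<theta> * x = 0" and 2: "cos \<theta> * x + sin \<theta> * y = 0"
    using NE NT by (simp_all add: E_def x_def y_def inner_add_right inner_diff_right)
  have cs: "cos \<theta> * cos \<theta> + sin \<theta> * sin \<theta> = 1"
    using sin_cos_squared_add3 .
  \<comment> \<open>Equations \<open>1\<close> and \<open>2\<close> form a homogeneous linear system
    in \<open>x\<close> and \<open>y\<close> whose matrix is orthogonal.\<close>
  have "x = 0" "y = 0"
    using cs 1 2 by algebra+
  then have N: "frenet_N \<beta> s = (frenet_N \<beta> s \<bullet> frenet_N \<gamma> s) *\<^sub>R frenet_N \<gamma> s"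
    using frenet_expansion[OF assms(1,2) s, of "frenet_N \<beta> s", folded x_def y_def] by simp
  have "\<bar>frenet_N \<beta> s \<bullet> frenet_N \<gamma> s\<bar> = 1"
    using arg_cong[OF N, of norm]
    by (simp add: norm_frenet_N[OF assms(1,2) s] norm_frenet_N[OF assms(1,3) s])
  then have "frenet_N \<beta> s \<bullet> frenet_N \<gamma> s \<in> {1, -1}"
    by (auto simp: abs_if split: if_splits)
  then show ?thesis
    by (rule bexI[rotated]) (rule N)
qed

theorem theorem3p1:
  fixes I :: "real set" and \<gamma> V :: "real \<Rightarrow> real^3" and u v w :: "real \<Rightarrow> real"
  assumes "open I" and "is_interval I"
    and "has_frenet_frame I \<gamma>"
    and "\<And>s. s \<in> I \<Longrightarrow> norm (vector_derivative \<gamma> (at s)) = 1"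
    and "\<And>s. s \<in> I \<Longrightarrow> u differentiable (at s)"
    and "\<And>s. s \<in> I \<Longrightarrow> v differentiable (at s)"
    and "\<And>s. s \<in> I \<Longrightarrow> w differentiable (at s)"
    and "\<And>s. s \<in> I \<Longrightarrow> (u s)\<^sup>2 + (v s)\<^sup>2 + (w s)\<^sup>2 = 1"
    and "\<And>s. s \<in> I \<Longrightarrow> V s = u s *\<^sub>R frenet_T \<gamma> s + v s *\<^sub>R frenet_N \<gamma> s + w s *\<^sub>R frenet_B \<gamma> s"
  shows "V_Bertrand_curve I \<gamma> V \<longleftrightarrow>
    (\<exists>lam \<beta> \<theta>. (\<forall>s\<in>I. lam differentiable (at s)) \<and>
       companion_curve I \<gamma> V lam \<beta> \<and> has_frenet_frame I \<beta> \<and>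
       (\<forall>s\<in>I. lam s * (curvature \<gamma> s * sin \<theta> + torsion \<gamma> s * cos \<theta>) = u s * sin \<theta> - w s * cos \<theta>) \<and>
       (\<forall>s\<in>I. (lam has_real_derivative - v s) (at s)) \<and>
       (\<forall>s\<in>I. tangent_angle \<gamma> \<beta> \<theta> s))"
proof
  note fr = assms(1,3)
  note orth = frenet_inner[OF fr]
  have sp: "speed \<gamma> s = 1" if "s \<in> I" for s
    using assms(4)[OF that] by (simp add: speed_def)
  assume "V_Bertrand_curve I \<gamma> V"
  then obtain lam \<beta> where lam: "\<forall>s\<in>I. lam differentiable (at s)"
    and cc: "companion_curve I \<gamma> V lam \<beta>" and fr\<beta>: "has_frenet_frame I \<beta>"
    and par: "\<forall>s\<in>I. \<exists>\<epsilon>\<in>{1, -1}. frenet_N \<beta> s = \<epsilon> *\<^sub>R frenet_N \<gamma> s"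
    by (auto simp: V_Bertrand_curve_def V_Bertrand_mate_def)
  obtain \<theta> where \<theta>: "\<And>s. s \<in> I \<Longrightarrow>
      frenet_T \<beta> s = cos \<theta> *\<^sub>R frenet_T \<gamma> s + sin \<theta> *\<^sub>R frenet_B \<gamma> s"
    using parallel_normals_imp_tangent_angle[OF assms(1,2,3) fr\<beta> par] by blast
  have eqs: "(lam has_real_derivative - v s) (at s) \<and>
      lam s * (curvature \<gamma> s * sin \<theta> + torsion \<gamma> s * cos \<theta>) = u s * sin \<theta> - w s * cos \<theta>"
    if s: "s \<in> I" for s
  proof -
    obtain l where l: "(lam has_real_derivative l) (at s)"
      using lam s real_differentiable_def by blast
    \<comment> \<open>Two expressions for the velocity of \<beta> are equated and then projected
      onto N, T and B in turn. The N component gives \<open>l = - v s\<close>; the other two express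
      \<open>speed \<beta> s * cos \<theta>\<close> and
      \<open>speed \<beta> s * sin \<theta>\<close>.\<close>
    have vel: "V s + lam s *\<^sub>R vector_derivative (frenet_N \<gamma>) (at s) + l *\<^sub>R frenet_N \<gamma> s
        = speed \<beta> s *\<^sub>R (cos \<theta> *\<^sub>R frenet_T \<gamma> s + sin \<theta> *\<^sub>R frenet_B \<gamma> s)" (is "?L = ?R")
      using velocity_companion_curve[OF fr cc s l] velocity_eq[OF assms(1) fr\<beta> s] \<theta>[OF s] by simp
    note simps = assms(9)[OF s] inner_add_left orth[OF s] frenet_N_derivative_inner[OF fr s] sp[OF s]
    have "?L \<bullet> frenet_N \<gamma> s = ?R \<bullet> frenet_N \<gamma> s"
      by (simp only: vel)
    then have "l = - v s" by (simp add: simps)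
    moreover have "?L \<bullet> frenet_T \<gamma> s = ?R \<bullet> frenet_T \<gamma> s"
      by (simp only: vel)
    then have "u s - lam s * curvature \<gamma> s = speed \<beta> s * cos \<theta>" by (simp add: simps)
    moreover have "?L \<bullet> frenet_B \<gamma> s = ?R \<bullet> frenet_B \<gamma> s"
      by (simp only: vel)
    then have "w s + lam s * torsion \<gamma> s = speed \<beta> s * sin \<theta>" by (simp add: simps)
    \<comment> \<open>The unknown speed is eliminated by taking sin \<theta> times the T equation
      minus cos \<theta> times the B equation. There is no division by cos \<theta>, so a right
      angle is covered.\<close>
    ultimately have "lam s * (curvature \<gamma> s * sin \<theta> + torsion \<gamma> s * cos \<theta>) = u s * sin \<theta> - w s * cos \<theta>"
      by algebra
    with l \<open>l = - v s\<close> show ?thesis by simp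
  qed
  have "\<forall>s\<in>I. tangent_angle \<gamma> \<beta> \<theta> s"
    using \<theta> by (simp add: tangent_angle_def)
  with lam cc fr\<beta> eqs show "\<exists>lam \<beta> \<theta>. (\<forall>s\<in>I. lam differentiable (at s)) \<and>
       companion_curve I \<gamma> V lam \<beta> \<and> has_frenet_frame I \<beta> \<and>
       (\<forall>s\<in>I. lam s * (curvature \<gamma> s * sin \<theta> + torsion \<gamma> s * cos \<theta>) = u s * sin \<theta> - w s * cos \<theta>) \<and>
       (\<forall>s\<in>I. (lam has_real_derivative - v s) (at s)) \<and>
       (\<forall>s\<in>I. tangent_angle \<gamma> \<beta> \<theta> s)"
    by blast
next
  assume "\<exists>lam \<beta> \<theta>. (\<forall>s\<in>I. lam differentiable (at s)) \<and>
       companion_curve I \<gamma> V lam \<beta> \<and> has_frenet_frame I \<beta> \<and>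
       (\<forall>s\<in>I. lam s * (curvature \<gamma> s * sin \<theta> + torsion \<gamma> s * cos \<theta>) = u s * sin \<theta> - w s * cos \<theta>) \<and>
       (\<forall>s\<in>I. (lam has_real_derivative - v s) (at s)) \<and>
       (\<forall>s\<in>I. tangent_angle \<gamma> \<beta> \<theta> s)"
  then obtain lam \<beta> \<theta> where "\<forall>s\<in>I. lam differentiable (at s)"
    and "companion_curve I \<gamma> V lam \<beta>" and fr\<beta>: "has_frenet_frame I \<beta>"
    and angle: "\<forall>s\<in>I. tangent_angle \<gamma> \<beta> \<theta> s"
    by blast
  \<comment> \<open>The same \<open>lam\<close> and \<beta> witness the Bertrand property.\<close>
  with tangent_angle_imp_parallel_normals[OF assms(1,3) fr\<beta> angle]
  show "V_Bertrand_curve I \<gamma> V"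
    unfolding V_Bertrand_curve_def V_Bertrand_mate_def by blast
qed

end
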